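(* Let $X,Y$ be complex Banach spaces and $N\in\mathbb{N}$. For $\alpha\in(0,1)$ let $s(\alpha,N)=\left(1-\alpha\cdot\frac{N!}{N^{N+1}}\right)^{1/N}$. Then, for every $\alpha\in(0,1)$: (1) $\|P\|_{s(\alpha,N)}\geq(1-\alpha)\|P\|_\infty$ for every $P\in\mathcal{P}^N(X;Y)$. (2) $\|P\|_v\geq[1-s(\alpha,N)^2](1-\alpha)\|P\|_\infty$ for every $P\in\mathcal{P}^N(X;Y)$. In particular, the norms $\|\cdot\|_{s(\alpha,N)}$, $\|\cdot\|_\infty$ and $\|\cdot\|_v$ are all equivalent to each other on $\mathcal{P}^N(X;Y)$.
   Context: $\mathbb{N}=\{1,2,\dots\}$. $B_X$ is the open unit ball of $X$. $\mathcal{P}^N(X;Y)$ is the space of (continuous) polynomials from $X$ to $Y$ of degree at most $N$, i.e. maps $P=\sum_{k=0}^NP_k$ with $P_k$ a continuous $k$-homogeneous polynomial ($P_k(x)=A_k(x,\dots,x)$ for a continuous symmetric $k$-linear map $A_k$; $P_0$ constant). $\|P\|_s=\sup_{x\in B_X}\|P(sx)\|$ for $s\in(0,1]$, $\|P\|_\infty=\|P\|_1=\sup_{x\in B_X}\|P(x)\|$, and $\|P\|_v=\sup_{x\in B_X}(1-\|x\|^2)\|P(x)\|$. *)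

theory Defs
  imports "HOL-Analysis.Analysis"
begin

(* Complex Banach spaces, as a refinement of the library's real Banach spaces. *)

class scaleC = scaleR +
  fixes scaleC :: "complex \<Rightarrow> 'a \<Rightarrow> 'a"  (infixr "*\<^sub>C" 75)
  assumes scaleR_scaleC: "r *\<^sub>R x = complex_of_real r *\<^sub>C x"

class complex_vector = scaleC + ab_group_add +
  assumes scaleC_add_right: "a *\<^sub>C (x + y) = a *\<^sub>C x + a *\<^sub>C y"
    and scaleC_add_left: "(a + b) *\<^sub>C x = a *\<^sub>C x + b *\<^sub>C x"
    and scaleC_scaleC: "a *\<^sub>C b *\<^sub>C x = (a * b) *\<^sub>C x"
    and scaleC_one: "1 *\<^sub>C x = x"

class complex_normed_vector = complex_vector + real_normed_vector +
  assumes norm_scaleC: "norm (a *\<^sub>C x) = cmod a * norm x"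

class cbanach = complex_normed_vector + complete_space

instantiation complex :: cbanach
begin

definition scaleC_complex :: "complex \<Rightarrow> complex \<Rightarrow> complex"
  where "scaleC_complex a x = a * x"

instance
  by standard (simp_all add: scaleC_complex_def scaleR_conv_of_real algebra_simps norm_mult)

end

(* Points of the k-fold product of the domain are the functions on nat that are
   extensional on {..<k}, i.e. the elements of the topological space
   product_topology (\<lambda>_. euclidean) {..<k}. *)

definition continuous_symmetric_multilinear ::
    "nat \<Rightarrow> ((nat \<Rightarrow> 'a::complex_normed_vector) \<Rightarrow> 'b::complex_normed_vector) \<Rightarrow> bool"
  where "continuous_symmetric_multilinear k A \<longleftrightarrow>
    continuous_map (product_topology (\<lambda>_. euclidean) {..<k}) euclidean A \<and>
    (\<forall>x \<in> extensional {..<k}. \<forall>i<k. \<forall>u v.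
       A (x(i := u + v)) = A (x(i := u)) + A (x(i := v))) \<and>
    (\<forall>x \<in> extensional {..<k}. \<forall>i<k. \<forall>c u.
       A (x(i := c *\<^sub>C u)) = c *\<^sub>C A (x(i := u))) \<and>
    (\<forall>x \<in> extensional {..<k}. \<forall>p. p permutes {..<k} \<longrightarrow> A (x \<circ> p) = A x)"

(* For k = 0 these are exactly the constant maps. *)

definition continuous_homogeneous_polynomial ::
    "nat \<Rightarrow> ('a::complex_normed_vector \<Rightarrow> 'b::complex_normed_vector) \<Rightarrow> bool"
  where "continuous_homogeneous_polynomial k P \<longleftrightarrow>
    (\<exists>A. continuous_symmetric_multilinear k A \<and> (\<forall>x. P x = A (\<lambda>i\<in>{..<k}. x)))"

definition polynomials_upto ::
    "nat \<Rightarrow> ('a::complex_normed_vector \<Rightarrow> 'b::complex_normed_vector) set"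
  where "polynomials_upto N =
    {P. \<exists>Q. (\<forall>k\<le>N. continuous_homogeneous_polynomial k (Q k)) \<and>
            (\<forall>x. P x = (\<Sum>k\<le>N. Q k x))}"

(* The suprema below are real-valued; they are meaningful for maps bounded on the
   unit ball, in particular for all continuous polynomials. *)

definition norm_scaled ::
    "real \<Rightarrow> ('a::complex_normed_vector \<Rightarrow> 'b::complex_normed_vector) \<Rightarrow> real"
  where "norm_scaled s P = (SUP x \<in> ball 0 1. norm (P (s *\<^sub>R x)))"

definition norm_sup :: "('a::complex_normed_vector \<Rightarrow> 'b::complex_normed_vector) \<Rightarrow> real"
  where "norm_sup P = (SUP x \<in> ball 0 1. norm (P x))"

definition norm_weighted :: "('a::complex_normed_vector \<Rightarrow> 'b::complex_normed_vector) \<Rightarrow> real"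
  where "norm_weighted P = (SUP x \<in> ball 0 1. (1 - (norm x)\<^sup>2) * norm (P x))"

definition norm_on ::
    "('a \<Rightarrow> 'b::complex_normed_vector) set \<Rightarrow> (('a \<Rightarrow> 'b) \<Rightarrow> real) \<Rightarrow> bool"
  where "norm_on V p \<longleftrightarrow>
    (\<forall>f\<in>V. 0 \<le> p f) \<and>
    (\<forall>f\<in>V. p f = 0 \<longleftrightarrow> f = (\<lambda>x. 0)) \<and>
    (\<forall>f\<in>V. \<forall>c. p (\<lambda>x. c *\<^sub>C f x) = cmod c * p f) \<and>
    (\<forall>f\<in>V. \<forall>g\<in>V. p (\<lambda>x. f x + g x) \<le> p f + p g)"

definition equivalent_norms_on ::
    "('a \<Rightarrow> 'b::complex_normed_vector) set \<Rightarrow> (('a \<Rightarrow> 'b) \<Rightarrow> real) \<Rightarrow> (('a \<Rightarrow> 'b) \<Rightarrow> real) \<Rightarrow> bool"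
  where "equivalent_norms_on V p q \<longleftrightarrow>
    norm_on V p \<and> norm_on V q \<and>
    (\<exists>c>0. \<exists>C>0. \<forall>f\<in>V. c * q f \<le> p f \<and> p f \<le> C * q f)"

definition s_radius :: "real \<Rightarrow> nat \<Rightarrow> real"
  where "s_radius \<alpha> N = (1 - \<alpha> * (fact N / real N ^ (N + 1))) powr (1 / real N)"

end

(* Averaging P over the rotations of x by the (N+1)-st roots of unity gives Cauchy's estimate
   norm (Q k x) \<le> norm_sup P for the homogeneous components Q k of P.  Hence
   norm (P x - P (s x)) \<le> (\<Sum>k=1..N. 1 - s^k) * norm_sup P \<le> N * (1 - s^N) * norm_sup P,
   and N * (1 - s^N) = \<alpha> * N! / N^N \<le> \<alpha>.  The weighted bound follows by
   evaluating the weight on the ball of radius s. *)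

theory Submission
  imports Defs
begin

section \<open>Scalar multiplication of sums and sums over roots of unity\<close>

lemma scaleC_sum_right:
  fixes c :: complex and f :: "'i \<Rightarrow> 'a::complex_vector"
  shows "c *\<^sub>C sum f A = (\<Sum>i\<in>A. c *\<^sub>C f i)"
proof -
  interpret additive "\<lambda>x::'a. c *\<^sub>C x"
    by standard (rule scaleC_add_right)
  show ?thesis by (rule sum)
qed

lemma scaleC_sum_left:
  fixes x :: "'a::complex_vector"
  shows "sum f A *\<^sub>C x = (\<Sum>i\<in>A. f i *\<^sub>C x)"
proof -
  interpret additive "\<lambda>c. c *\<^sub>C x"
    by standard (rule scaleC_add_left)
  show ?thesis by (rule sum)
qed

lemma scaleC_zero_left: "0 *\<^sub>C (x::'a::complex_vector) = 0"
  using scaleR_scaleC[of 0 x] scaleC_add_left[of 0 0 x] by simp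

text \<open>A geometric sum whose ratio is an \<open>M\<close>-th root of unity: its closed form
  vanishes unless the ratio is 1, which happens exactly for \<open>M dvd n\<close>. This is the
  orthogonality relation that later isolates one homogeneous component.\<close>

lemma sum_powers_root_of_unity:
  assumes "M > 0"
  shows "(\<Sum>j<M. exp (2 * of_real pi * \<i> * of_nat n / of_nat M) ^ j) =
    (if M dvd n then of_nat M else 0 :: complex)"
proof (cases "M dvd n")
  case True
  then have "exp (2 * of_real pi * \<i> * of_nat n / of_nat M) = (1::complex)"
    using complex_root_unity_eq_1[of M n] assms by simp
  with True show ?thesis by simp
next
  case False
  let ?z = "exp (2 * of_real pi * \<i> * of_nat n / of_nat M) :: complex"
  have "?z \<noteq> 1"
    using complex_root_unity_eq_1[of M n] assms False by simp
  moreover have "?z ^ M = 1"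
    using assms complex_root_unity[of M n] by simp
  ultimately show ?thesis
    using False by (simp add: geometric_sum)
qed

section \<open>Homogeneity, continuity and boundedness of polynomials\<close>

text \<open>Homogeneity is available for one slot at a time, so the scalar is pulled out of the
  \<open>k\<close> slots successively.\<close>

lemma multilinear_diagonal_scaleC:
  fixes A :: "(nat \<Rightarrow> 'a::complex_normed_vector) \<Rightarrow> 'b::complex_normed_vector"
  assumes "continuous_symmetric_multilinear k A"
  shows "A (\<lambda>i\<in>{..<k}. c *\<^sub>C x) = c ^ k *\<^sub>C A (\<lambda>i\<in>{..<k}. x)"
proof -
  \<comment> \<open>\<open>y m\<close> interpolates between the two diagonal points: only its first
    \<open>m\<close> slots carry the factor \<open>c\<close>.\<close>
  define y where "y m = (\<lambda>i\<in>{..<k}. if i < m then c *\<^sub>C x else x)" for m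
  have hom: "A (z(i := c *\<^sub>C u)) = c *\<^sub>C A (z(i := u))"
    if "z \<in> extensional {..<k}" "i < k" for z i u
    using assms that unfolding continuous_symmetric_multilinear_def by blast
  have "A (y m) = c ^ m *\<^sub>C A (\<lambda>i\<in>{..<k}. x)" if "m \<le> k" for m
    using that
  proof (induction m)
    case 0
    show ?case by (simp add: y_def scaleC_one)
  next
    case (Suc m)
    \<comment> \<open>Slot \<open>m\<close> of \<open>y m\<close> still holds the unscaled
      \<open>x\<close>, so homogeneity in that slot leads from \<open>y m\<close> to
      \<open>y (Suc m)\<close> at the cost of one factor \<open>c\<close>.\<close>
    have next_y: "y (Suc m) = (y m)(m := c *\<^sub>C x)" and same_y: "(y m)(m := x) = y m"
      using Suc.prems by (auto simp: y_def fun_eq_iff less_Suc_eq)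
    have "A (y (Suc m)) = c *\<^sub>C A ((y m)(m := x))"
      unfolding next_y using Suc.prems by (intro hom) (auto simp: y_def)
    then show ?case
      unfolding same_y using Suc by (simp add: scaleC_scaleC)
  qed
  from this[of k] show ?thesis
    by (simp add: y_def restrict_def cong: if_cong)
qed

lemma continuous_homogeneous_polynomial_scaleC:
  assumes "continuous_homogeneous_polynomial k P"
  shows "P (c *\<^sub>C x) = c ^ k *\<^sub>C P x"
  using assms multilinear_diagonal_scaleC
  unfolding continuous_homogeneous_polynomial_def by metis

lemma continuous_homogeneous_polynomial_scaleR:
  assumes "continuous_homogeneous_polynomial k P"
  shows "P (r *\<^sub>R x) = r ^ k *\<^sub>R P x"
  using continuous_homogeneous_polynomial_scaleC[OF assms, of "of_real r" x]
  by (simp add: scaleR_scaleC)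

text \<open>\<open>P\<close> is the multilinear map composed with the diagonal embedding, which is
  continuous into the product topology because each coordinate is the identity.\<close>

lemma continuous_homogeneous_polynomial_continuous_on:
  fixes P :: "'a::complex_normed_vector \<Rightarrow> 'b::complex_normed_vector"
  assumes "continuous_homogeneous_polynomial k P"
  shows "continuous_on UNIV P"
proof -
  obtain A where A: "continuous_symmetric_multilinear k A" "\<And>x. P x = A (\<lambda>i\<in>{..<k}. x)"
    using assms unfolding continuous_homogeneous_polynomial_def by blast
  have "continuous_map euclidean (product_topology (\<lambda>_. euclidean) {..<k})
      (\<lambda>x::'a. \<lambda>i\<in>{..<k}. x)"
    by (auto simp: continuous_map_componentwise)
  moreover have "continuous_map (product_topology (\<lambda>_. euclidean) {..<k}) euclidean A"
    using A(1) by (simp add: continuous_symmetric_multilinear_def)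
  ultimately have "continuous_map euclidean euclidean (A \<circ> (\<lambda>x. \<lambda>i\<in>{..<k}. x))"
    by (rule continuous_map_compose)
  moreover have "A \<circ> (\<lambda>x. \<lambda>i\<in>{..<k}. x) = P"
    using A(2) by (simp add: fun_eq_iff)
  ultimately show ?thesis by simp
qed

text \<open>Continuity at 0 bounds \<open>P\<close> on some ball of radius \<open>d\<close>;
  homogeneity carries this bound to the unit ball at the cost of a factor
  \<open>1 / d ^ k\<close>.\<close>

lemma continuous_homogeneous_polynomial_bounded:
  fixes P :: "'a::complex_normed_vector \<Rightarrow> 'b::complex_normed_vector"
  assumes "continuous_homogeneous_polynomial k P"
  shows "\<exists>B. \<forall>x\<in>ball 0 1. norm (P x) \<le> B"
proof -
  have "isCont P 0"
    using continuous_homogeneous_polynomial_continuous_on[OF assms]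
    by (simp add: continuous_on_eq_continuous_at)
  then obtain d where d: "d > 0" "\<And>x. dist x 0 < d \<Longrightarrow> dist (P x) (P 0) < 1"
    unfolding continuous_at_eps_delta by (metis zero_less_one)
  have "norm (P x) \<le> (norm (P 0) + 1) / d ^ k" if "x \<in> ball 0 1" for x
  proof -
    have "dist (d *\<^sub>R x) 0 < d"
      using that d(1) by simp
    then have "norm (P (d *\<^sub>R x)) \<le> norm (P 0) + 1"
      using d(2)[of "d *\<^sub>R x"] norm_triangle_ineq2[of "P (d *\<^sub>R x)" "P 0"]
      by (simp add: dist_norm)
    then show ?thesis
      using d(1) continuous_homogeneous_polynomial_scaleR[OF assms, of d x]
      by (simp add: field_simps)
  qed
  then show ?thesis by blast
qed

lemma polynomials_upto_bounded:
  assumes "P \<in> polynomials_upto N"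
  shows "\<exists>B. \<forall>x\<in>ball 0 1. norm (P x) \<le> B"
proof -
  obtain Q where Q: "\<And>k. k \<le> N \<Longrightarrow> continuous_homogeneous_polynomial k (Q k)"
      "\<And>x. P x = (\<Sum>k\<le>N. Q k x)"
    using assms unfolding polynomials_upto_def by blast
  have "\<forall>k. \<exists>B. k \<le> N \<longrightarrow> (\<forall>x\<in>ball 0 1. norm (Q k x) \<le> B)"
    using Q(1) continuous_homogeneous_polynomial_bounded by blast
  then obtain B where B: "\<And>k x. k \<le> N \<Longrightarrow> x \<in> ball 0 1 \<Longrightarrow> norm (Q k x) \<le> B k"
    by metis
  have "norm (P x) \<le> sum B {..N}" if "x \<in> ball 0 1" for x
    unfolding Q(2) using B that by (intro sum_norm_le) auto
  then show ?thesis by blast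
qed

section \<open>Cauchy estimates and their consequences\<close>

text \<open>Discrete Fourier inversion along the orbit of \<open>x\<close> under multiplication by
  roots of unity. The orbit stays on the sphere through \<open>x\<close>, so a bound there suffices;
  this lets the estimate serve both for the sup norm and for polynomials vanishing near 0.\<close>

lemma homogeneous_component_norm_le:
  fixes Q :: "nat \<Rightarrow> 'a::complex_normed_vector \<Rightarrow> 'b::complex_normed_vector"
  assumes hom: "\<And>m. m \<le> N \<Longrightarrow> continuous_homogeneous_polynomial m (Q m)"
    and P: "\<And>x. P x = (\<Sum>m\<le>N. Q m x)"
    and bound: "\<And>y. norm y = norm x \<Longrightarrow> norm (P y) \<le> B"
    and "k \<le> N"
  shows "norm (Q k x) \<le> B"
proof -
  \<comment> \<open>With \<open>N + 1\<close> roots the degrees 0 to \<open>N\<close> are pairwise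
    distinct modulo \<open>M\<close>.\<close>
  define M where "M = Suc N"
  define w where "w = exp (2 * of_real pi * \<i> / of_nat M)"
  have w_power: "w ^ n = exp (2 * of_real pi * \<i> * of_nat n / of_nat M)" for n
    unfolding w_def by (simp add: exp_of_nat_mult [symmetric] mult_ac)
  have norm_w: "cmod w = 1"
    unfolding w_def by (simp add: norm_exp_eq_Re)
  \<comment> \<open>The exponent \<open>M - k\<close> plays the part of \<open>-k\<close>, since
    \<open>w ^ M = 1\<close>, and keeps all exponents natural.\<close>
  have orth: "(\<Sum>j<M. w ^ (j * (m + (M - k)))) = (if m = k then of_nat M else 0)" if "m \<le> N" for m
  proof -
    have "M dvd m + (M - k) \<longleftrightarrow> m = k"
    proof
      assume "M dvd m + (M - k)"
      then obtain q where q: "m + (M - k) = M * q" by (elim dvdE)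
      \<comment> \<open>The only multiple of \<open>M\<close> strictly between 0 and
        \<open>2 * M\<close> is \<open>M\<close> itself.\<close>
      have "0 < m + (M - k)" "m + (M - k) < M * 2"
        using \<open>k \<le> N\<close> that by (auto simp: M_def)
      then have "0 < q" "q < 2"
        unfolding q by simp_all
      then have "q = 1" by simp
      then show "m = k"
        using q \<open>k \<le> N\<close> by (simp add: M_def)
    qed (use \<open>k \<le> N\<close> in \<open>auto simp: M_def\<close>)
    moreover have "(\<Sum>j<M. w ^ (j * (m + (M - k)))) = (\<Sum>j<M. (w ^ (m + (M - k))) ^ j)"
      by (simp only: power_mult[symmetric] mult.commute)
    ultimately show ?thesis
      unfolding w_power using sum_powers_root_of_unity[of M "m + (M - k)"] by (simp add: M_def)
  qed
  have "(\<Sum>j<M. w ^ (j * (M - k)) *\<^sub>C P (w ^ j *\<^sub>C x)) =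
      (\<Sum>j<M. \<Sum>m\<le>N. w ^ (j * (m + (M - k))) *\<^sub>C Q m x)"
    unfolding P
    by (intro sum.cong refl)
      (auto simp: scaleC_sum_right continuous_homogeneous_polynomial_scaleC[OF hom] scaleC_scaleC
        power_mult[symmetric] power_add[symmetric] algebra_simps intro!: sum.cong)
  also have "\<dots> = (\<Sum>m\<le>N. (\<Sum>j<M. w ^ (j * (m + (M - k)))) *\<^sub>C Q m x)"
    by (subst sum.swap) (simp add: scaleC_sum_left)
  also have "\<dots> = (\<Sum>m\<le>N. if m = k then of_nat M *\<^sub>C Q m x else 0)"
    by (intro sum.cong) (auto simp: orth scaleC_zero_left)
  also have "\<dots> = of_nat M *\<^sub>C Q k x"
    using \<open>k \<le> N\<close> by simp
  finally have "real M * norm (Q k x) = norm (\<Sum>j<M. w ^ (j * (M - k)) *\<^sub>C P (w ^ j *\<^sub>C x))"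
    by (simp add: norm_scaleC)
  also have "\<dots> \<le> (\<Sum>j<M. B)"
    by (intro sum_norm_le) (simp add: norm_scaleC norm_power norm_w bound)
  finally show ?thesis
    by (simp add: M_def)
qed

text \<open>Dilation by \<open>s\<close> multiplies the degree \<open>k\<close> component by
  \<open>s ^ k\<close>. Each component is at most \<open>B\<close> by the Cauchy estimate, and
  \<open>1 - s ^ k\<close> is at most \<open>1 - s ^ N\<close>.\<close>

lemma polynomials_upto_dilation_norm_le:
  fixes P :: "'a::complex_normed_vector \<Rightarrow> 'b::complex_normed_vector"
  assumes "P \<in> polynomials_upto N" and s: "0 \<le> s" "s \<le> 1"
    and bound: "\<And>y. norm y = norm x \<Longrightarrow> norm (P y) \<le> B"
  shows "norm (P x - P (s *\<^sub>R x)) \<le> real N * (1 - s ^ N) * B"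
proof -
  obtain Q where Q: "\<And>k. k \<le> N \<Longrightarrow> continuous_homogeneous_polynomial k (Q k)"
      "\<And>x. P x = (\<Sum>k\<le>N. Q k x)"
    using assms(1) unfolding polynomials_upto_def by blast
  have B: "0 \<le> B" using bound[of x] norm_ge_zero[of "P x"] by linarith
  have "P x - P (s *\<^sub>R x) = (\<Sum>k\<le>N. (1 - s ^ k) *\<^sub>R Q k x)"
    unfolding Q(2) sum_subtractf[symmetric]
    by (intro sum.cong refl)
      (simp add: continuous_homogeneous_polynomial_scaleR[OF Q(1)] scaleR_left_diff_distrib)
  \<comment> \<open>The constant component cancels because \<open>s ^ 0 = 1\<close>; hence the
    factor \<open>N\<close> rather than \<open>N + 1\<close>.\<close>
  also have "\<dots> = (\<Sum>k=1..N. (1 - s ^ k) *\<^sub>R Q k x)"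
    by (intro sum.mono_neutral_right) (auto simp: Suc_le_eq)
  finally have "norm (P x - P (s *\<^sub>R x)) \<le> (\<Sum>k=1..N. (1 - s ^ N) * B)"
  proof (simp only:, intro sum_norm_le)
    fix k assume k: "k \<in> {1..N}"
    then have "s ^ N \<le> s ^ k" "s ^ k \<le> 1"
      using s by (auto intro: power_decreasing power_le_one)
    moreover have "norm (Q k x) \<le> B"
      using homogeneous_component_norm_le[OF Q(1) Q(2) bound, where k = k] k by simp
    ultimately show "norm ((1 - s ^ k) *\<^sub>R Q k x) \<le> (1 - s ^ N) * B"
      by (auto intro!: mult_mono)
  qed
  then show ?thesis by simp
qed

text \<open>The Cauchy estimate with bound 0 kills every component at a small multiple of
  \<open>x\<close>, and homogeneity carries this back to \<open>x\<close>. It yields definiteness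
  even for the scaled norm, which sees \<open>P\<close> only on a smaller ball.\<close>

lemma polynomials_upto_eq_zero:
  fixes P :: "'a::complex_normed_vector \<Rightarrow> 'b::complex_normed_vector"
  assumes "P \<in> polynomials_upto N" and "0 < s" and zero: "\<And>x. x \<in> ball 0 s \<Longrightarrow> P x = 0"
  shows "P = (\<lambda>x. 0)"
proof
  fix x :: 'a
  obtain Q where Q: "\<And>k. k \<le> N \<Longrightarrow> continuous_homogeneous_polynomial k (Q k)"
      "\<And>x. P x = (\<Sum>k\<le>N. Q k x)"
    using assms(1) unfolding polynomials_upto_def by blast
  \<comment> \<open>The summand 1 keeps the denominator positive at \<open>x = 0\<close> and makes
    \<open>norm (r *\<^sub>R x) < s\<close> strict.\<close>
  define r where "r = s / (norm x + 1)"
  have pos: "norm x + 1 > 0"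
    using norm_ge_zero[of x] by linarith
  then have r: "r > 0"
    unfolding r_def using \<open>0 < s\<close> by simp
  have small: "norm (r *\<^sub>R x) < s"
    unfolding r_def using pos \<open>0 < s\<close> by (simp add: field_simps)
  have "Q k x = 0" if "k \<le> N" for k
  proof -
    have "norm (Q k (r *\<^sub>R x)) \<le> 0"
      using small by (intro homogeneous_component_norm_le[OF Q(1) Q(2) _ that]) (auto simp: zero)
    then have "Q k (r *\<^sub>R x) = 0" by simp
    then show ?thesis
      using r continuous_homogeneous_polynomial_scaleR[OF Q(1)[OF that], of r x] by simp
  qed
  then show "P x = 0" by (simp add: Q(2))
qed

section \<open>The three suprema as norms\<close>

text \<open>The scaled, uniform and weighted norms are all of the form
  \<^term>\<open>SUP x\<in>S. w x * norm (f (g x))\<close>.\<close>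

lemma norm_on_weighted_sup:
  fixes V :: "('a \<Rightarrow> 'b::complex_normed_vector) set"
  assumes "S \<noteq> {}" and w: "\<And>x. x \<in> S \<Longrightarrow> 0 \<le> w x"
    and bdd: "\<And>f. f \<in> V \<Longrightarrow> bdd_above ((\<lambda>x. w x * norm (f (g x))) ` S)"
    and zero: "\<And>f. f \<in> V \<Longrightarrow> (\<And>x. x \<in> S \<Longrightarrow> w x * norm (f (g x)) = 0) \<Longrightarrow> f = (\<lambda>x. 0)"
  shows "norm_on V (\<lambda>f. SUP x\<in>S. w x * norm (f (g x)))"
proof -
  have upper: "w x * norm (f (g x)) \<le> (SUP x\<in>S. w x * norm (f (g x)))" if "f \<in> V" "x \<in> S" for f x
    using that bdd by (intro cSUP_upper)
  have nonneg: "0 \<le> (SUP x\<in>S. w x * norm (f (g x)))" if "f \<in> V" for f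
  proof -
    obtain x where "x \<in> S" using \<open>S \<noteq> {}\<close> by blast
    then show ?thesis
      using upper[OF that] w by (meson mult_nonneg_nonneg norm_ge_zero order_trans)
  qed
  have scale: "(SUP x\<in>S. w x * norm (c *\<^sub>C f (g x))) = cmod c * (SUP x\<in>S. w x * norm (f (g x)))"
    if "f \<in> V" for f c
  proof -
    have "(SUP x\<in>S. cmod c * (w x * norm (f (g x)))) = cmod c * (SUP x\<in>S. w x * norm (f (g x)))"
    \<comment> \<open>The case \<open>c = 0\<close> is split off because the reverse inequality
      divides by \<open>cmod c\<close>.\<close>
    proof (cases "c = 0")
      case True
      then show ?thesis using \<open>S \<noteq> {}\<close> by simp
    next
      case False
      show ?thesis
      proof (rule antisym)
        show "(SUP x\<in>S. cmod c * (w x * norm (f (g x)))) \<le> cmod c * (SUP x\<in>S. w x * norm (f (g x)))"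
          using \<open>S \<noteq> {}\<close> by (intro cSUP_least mult_left_mono upper that) auto
        have "bdd_above ((\<lambda>x. cmod c * (w x * norm (f (g x)))) ` S)"
          by (rule bdd_aboveI2) (rule mult_left_mono[OF upper[OF that] norm_ge_zero])
        then have "cmod c * (w x * norm (f (g x))) \<le> (SUP x\<in>S. cmod c * (w x * norm (f (g x))))"
          if "x \<in> S" for x
          using that by (intro cSUP_upper)
        then have "(SUP x\<in>S. w x * norm (f (g x))) \<le>
            (SUP x\<in>S. cmod c * (w x * norm (f (g x)))) / cmod c"
          using \<open>S \<noteq> {}\<close> False by (intro cSUP_least) (auto simp: pos_le_divide_eq mult_ac)
        then show "cmod c * (SUP x\<in>S. w x * norm (f (g x))) \<le>
            (SUP x\<in>S. cmod c * (w x * norm (f (g x))))"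
          using False by (simp add: pos_le_divide_eq mult_ac)
      qed
    qed
    then show ?thesis by (simp add: norm_scaleC mult_ac)
  qed
  have triangle: "(SUP x\<in>S. w x * norm (f (g x) + h (g x))) \<le>
      (SUP x\<in>S. w x * norm (f (g x))) + (SUP x\<in>S. w x * norm (h (g x)))"
    if "f \<in> V" "h \<in> V" for f h
  proof (rule cSUP_least[OF \<open>S \<noteq> {}\<close>])
    fix x assume x: "x \<in> S"
    have "w x * norm (f (g x) + h (g x)) \<le> w x * (norm (f (g x)) + norm (h (g x)))"
      using x w by (intro mult_left_mono norm_triangle_ineq)
    also have "\<dots> = w x * norm (f (g x)) + w x * norm (h (g x))"
      by (simp add: algebra_simps)
    also have "\<dots> \<le> (SUP x\<in>S. w x * norm (f (g x))) + (SUP x\<in>S. w x * norm (h (g x)))"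
      using x that by (intro add_mono upper)
    finally show "w x * norm (f (g x) + h (g x)) \<le> \<dots>" .
  qed
  have "f = (\<lambda>x. 0)" if "f \<in> V" "(SUP x\<in>S. w x * norm (f (g x))) = 0" for f
  proof (rule zero[OF that(1)])
    fix x assume x: "x \<in> S"
    show "w x * norm (f (g x)) = 0"
      using upper[OF that(1) x] that(2) w[OF x]
      by (intro antisym mult_nonneg_nonneg) auto
  qed
  moreover have "(SUP x\<in>S. w x * norm ((\<lambda>x. 0 :: 'b) (g x))) = 0"
    using \<open>S \<noteq> {}\<close> by simp
  ultimately show ?thesis
    unfolding norm_on_def using nonneg scale triangle by blast
qed

lemma polynomials_upto_norm_le_norm_sup:
  assumes "P \<in> polynomials_upto N" and "x \<in> ball 0 1"
  shows "norm (P x) \<le> norm_sup P"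
  unfolding norm_sup_def
  using polynomials_upto_bounded[OF assms(1)] assms(2) by (intro cSUP_upper) (auto simp: bdd_above_def)

lemma scaleR_in_unit_ball:
  fixes x :: "'a::real_normed_vector"
  assumes "0 < s" "s \<le> 1" "x \<in> ball 0 1"
  shows "s *\<^sub>R x \<in> ball 0 1"
  using assms mult_left_le_one_le[of "norm x" s] by auto

lemma one_minus_norm_squared_pos:
  fixes x :: "'a::real_normed_vector"
  assumes "x \<in> ball 0 1"
  shows "0 < 1 - (norm x)\<^sup>2"
  using assms by (simp add: power_less_one_iff abs_square_less_1)

text \<open>A common majorant: it supplies the boundedness that makes all three real suprema
  meaningful, and the upper comparisons with \<open>norm_sup\<close>.\<close>

lemma weighted_value_le_norm_sup:
  assumes P: "P \<in> polynomials_upto N" and s: "0 < s" "s \<le> 1" and x: "x \<in> ball 0 1"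
    and c: "0 \<le> c" "c \<le> 1"
  shows "c * norm (P (s *\<^sub>R x)) \<le> norm_sup P"
proof -
  have "c * norm (P (s *\<^sub>R x)) \<le> norm (P (s *\<^sub>R x))"
    using c by (intro mult_left_le_one_le) auto
  also have "\<dots> \<le> norm_sup P"
    by (intro polynomials_upto_norm_le_norm_sup[OF P] scaleR_in_unit_ball s x)
  finally show ?thesis .
qed

text \<open>All three norms are instances: weight 1 with radius \<open>s\<close>, weight 1 with
  radius 1, and weight \<open>1 - (norm x)\<^sup>2\<close> with radius 1. Strict positivity of the
  weight makes a vanishing norm force \<open>f\<close> to vanish on \<open>ball 0 s\<close>.\<close>

lemma norm_on_polynomials_upto:
  fixes w :: "'a::complex_normed_vector \<Rightarrow> real"
  assumes s: "0 < s" "s \<le> 1"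
    and w: "\<And>x. x \<in> ball 0 1 \<Longrightarrow> 0 < w x \<and> w x \<le> 1"
  shows "norm_on (polynomials_upto N :: ('a \<Rightarrow> 'b::complex_normed_vector) set)
    (\<lambda>f. SUP x\<in>ball 0 1. w x * norm (f (s *\<^sub>R x)))"
proof (rule norm_on_weighted_sup)
  fix f :: "'a \<Rightarrow> 'b" assume f: "f \<in> polynomials_upto N"
  show "bdd_above ((\<lambda>x. w x * norm (f (s *\<^sub>R x))) ` ball 0 1)"
    using w by (intro bdd_aboveI2[where M = "norm_sup f"] weighted_value_le_norm_sup[OF f s])
      (auto intro: less_imp_le)
  assume zero: "\<And>x. x \<in> ball 0 1 \<Longrightarrow> w x * norm (f (s *\<^sub>R x)) = 0"
  show "f = (\<lambda>x. 0)"
  proof (rule polynomials_upto_eq_zero[OF f s(1)])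
    fix x :: 'a assume "x \<in> ball 0 s"
    then have ball: "x /\<^sub>R s \<in> ball 0 1"
      using s(1) by (simp add: field_simps)
    show "f x = 0"
      using zero[OF ball] w[OF ball] s(1) by simp
  qed
qed (use w in \<open>auto intro: less_imp_le\<close>)

lemma norm_on_norm_scaled:
  assumes "0 < s" "s \<le> 1"
  shows "norm_on (polynomials_upto N :: ('a::complex_normed_vector \<Rightarrow> 'b::complex_normed_vector) set) (norm_scaled s)"
  using norm_on_polynomials_upto[OF assms, of "\<lambda>_::'a. 1" N, where ?'b = 'b]
  by (simp add: norm_scaled_def[abs_def])

lemma norm_on_norm_sup:
  "norm_on (polynomials_upto N :: ('a::complex_normed_vector \<Rightarrow> 'b::complex_normed_vector) set) norm_sup"
  using norm_on_polynomials_upto[of 1 "\<lambda>_::'a. 1" N, where ?'b = 'b]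
  by (simp add: norm_sup_def[abs_def])

lemma norm_on_norm_weighted:
  "norm_on (polynomials_upto N :: ('a::complex_normed_vector \<Rightarrow> 'b::complex_normed_vector) set) norm_weighted"
  using norm_on_polynomials_upto[of 1 "\<lambda>x::'a. 1 - (norm x)\<^sup>2" N, where ?'b = 'b]
    one_minus_norm_squared_pos[where ?'a = 'a]
  by (simp add: norm_weighted_def[abs_def])

section \<open>Comparison of the three norms\<close>

lemma norm_scaled_le_norm_sup:
  assumes "P \<in> polynomials_upto N" "0 < s" "s \<le> 1"
  shows "norm_scaled s P \<le> norm_sup P"
  unfolding norm_scaled_def
  using weighted_value_le_norm_sup[OF assms, of _ 1] by (intro cSUP_least) auto

lemma norm_weighted_upper:
  assumes "P \<in> polynomials_upto N" "x \<in> ball 0 1"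
  shows "(1 - (norm x)\<^sup>2) * norm (P x) \<le> norm_weighted P"
  unfolding norm_weighted_def
proof (intro cSUP_upper bdd_aboveI2 assms(2))
  fix y :: 'a assume "y \<in> ball 0 1"
  then show "(1 - (norm y)\<^sup>2) * norm (P y) \<le> norm_sup P"
    using weighted_value_le_norm_sup[OF assms(1), of 1 y "1 - (norm y)\<^sup>2"]
      one_minus_norm_squared_pos[of y] by simp
qed

lemma norm_weighted_le_norm_sup:
  assumes "P \<in> polynomials_upto N"
  shows "norm_weighted P \<le> norm_sup P"
  unfolding norm_weighted_def
proof (intro cSUP_least)
  fix y :: 'a assume "y \<in> ball 0 1"
  then show "(1 - (norm y)\<^sup>2) * norm (P y) \<le> norm_sup P"
    using weighted_value_le_norm_sup[OF assms(1), of 1 y "1 - (norm y)\<^sup>2"]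
      one_minus_norm_squared_pos[of y] by simp
qed simp

text \<open>Split \<open>P x\<close> into \<open>P (s *\<^sub>R x)\<close> and the dilation error,
  and absorb the error into the left-hand side after taking the supremum.\<close>

lemma norm_sup_le_norm_scaled:
  assumes P: "P \<in> polynomials_upto N" and s: "0 < s" "s \<le> 1"
  shows "(1 - real N * (1 - s ^ N)) * norm_sup P \<le> norm_scaled s P"
proof -
  have "norm_sup P \<le> norm_scaled s P + real N * (1 - s ^ N) * norm_sup P"
  proof (subst norm_sup_def, rule cSUP_least)
    fix x :: 'a assume x: "x \<in> ball 0 1"
    \<comment> \<open>The sphere through \<open>x\<close> lies in the open unit ball, so
      \<open>norm_sup P\<close> is an admissible bound for the dilation estimate.\<close>
    have "norm (P y) \<le> norm_sup P" if "norm y = norm x" for y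
      using x that by (intro polynomials_upto_norm_le_norm_sup[OF P]) simp
    then have "norm (P x - P (s *\<^sub>R x)) \<le> real N * (1 - s ^ N) * norm_sup P"
      using s by (intro polynomials_upto_dilation_norm_le[OF P]) auto
    moreover have "norm (P (s *\<^sub>R x)) \<le> norm_scaled s P"
      unfolding norm_scaled_def
      using weighted_value_le_norm_sup[OF P s, of _ 1] x by (intro cSUP_upper bdd_aboveI2) auto
    ultimately show "norm (P x) \<le> norm_scaled s P + real N * (1 - s ^ N) * norm_sup P"
      using norm_triangle_ineq2[of "P x" "P (s *\<^sub>R x)"] by linarith
  qed simp
  then show ?thesis by (simp add: algebra_simps)
qed

text \<open>The points \<open>s *\<^sub>R x\<close> have norm at most \<open>s\<close>, where the
  weight is at least \<open>1 - s\<^sup>2\<close>.\<close>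

lemma norm_scaled_le_norm_weighted:
  assumes P: "P \<in> polynomials_upto N" and s: "0 < s" "s < 1"
  shows "(1 - s\<^sup>2) * norm_scaled s P \<le> norm_weighted P"
proof -
  have s2: "0 < 1 - s\<^sup>2"
    using s by (simp add: power_less_one_iff abs_square_less_1)
  have "norm_scaled s P \<le> norm_weighted P / (1 - s\<^sup>2)"
    unfolding norm_scaled_def
  proof (rule cSUP_least)
    fix x :: 'a assume x: "x \<in> ball 0 1"
    have "(norm (s *\<^sub>R x))\<^sup>2 \<le> s\<^sup>2"
      using x s mult_left_le[of "norm x" s] by (intro power_mono) auto
    then have "(1 - s\<^sup>2) * norm (P (s *\<^sub>R x)) \<le> (1 - (norm (s *\<^sub>R x))\<^sup>2) * norm (P (s *\<^sub>R x))"
      by (intro mult_right_mono) auto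
    also have "\<dots> \<le> norm_weighted P"
      using s x by (intro norm_weighted_upper[OF P] scaleR_in_unit_ball) auto
    finally show "norm (P (s *\<^sub>R x)) \<le> norm_weighted P / (1 - s\<^sup>2)"
      using s2 by (simp add: pos_le_divide_eq mult.commute)
  qed simp
  then show ?thesis
    using s2 by (simp add: pos_le_divide_eq mult.commute)
qed

section \<open>The choice of radius and the final estimates\<close>

lemma s_radius_bounds:
  assumes "1 \<le> N" "0 < \<alpha>" "\<alpha> < 1"
  shows "0 < s_radius \<alpha> N" "s_radius \<alpha> N < 1" "real N * (1 - s_radius \<alpha> N ^ N) \<le> \<alpha>"
proof -
  define b :: real where "b = fact N / real N ^ (N + 1)"
  have N: "0 < real N" "1 \<le> real N" using assms(1) by auto
  have "fact N \<le> real N ^ N"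
    using fact_le_power[of N, where ?'a = real] by simp
  \<comment> \<open>This inequality serves twice: it gives \<open>b \<le> 1\<close>, which keeps the
    base of the power positive, and it gives the final bound by \<open>\<alpha>\<close>.\<close>
  then have Nb: "real N * b \<le> 1"
    unfolding b_def using N by (simp add: field_simps)
  have b: "0 < b"
    unfolding b_def using N by simp
  then have "b \<le> 1"
    using Nb mult_right_mono[of 1 "real N" b] N by linarith
  then have "\<alpha> * b < 1"
    using assms b mult_left_le[of b \<alpha>] by linarith
  moreover have "0 < \<alpha> * b"
    using assms b by simp
  ultimately have base: "0 < 1 - \<alpha> * b" "1 - \<alpha> * b < 1"
    by auto
  have s: "s_radius \<alpha> N = (1 - \<alpha> * b) powr (1 / real N)"
    by (simp add: s_radius_def b_def)
  show pos: "0 < s_radius \<alpha> N"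
    unfolding s using base by simp
  show "s_radius \<alpha> N < 1"
    unfolding s using base N powr_less_mono2[of "1 / real N" "1 - \<alpha> * b" 1] by simp
  \<comment> \<open>Passing to a real exponent lets \<open>N\<close> cancel against
    \<open>1 / N\<close>.\<close>
  have "s_radius \<alpha> N ^ N = s_radius \<alpha> N powr real N"
    using pos by (simp add: powr_realpow)
  also have "\<dots> = 1 - \<alpha> * b"
    unfolding s using base N by (simp add: powr_powr)
  finally have "real N * (1 - s_radius \<alpha> N ^ N) = \<alpha> * (real N * b)"
    by simp
  also have "\<dots> \<le> \<alpha>"
    using Nb assms(2) mult_left_le[of "real N * b" \<alpha>] by simp
  finally show "real N * (1 - s_radius \<alpha> N ^ N) \<le> \<alpha>" .
qed

lemma equivalent_norms_onI:
  assumes "norm_on V p" "norm_on V q" "0 < c" "0 < C"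
    and "\<And>f. f \<in> V \<Longrightarrow> c * q f \<le> p f" "\<And>f. f \<in> V \<Longrightarrow> p f \<le> C * q f"
  shows "equivalent_norms_on V p q"
  using assms unfolding equivalent_norms_on_def by blast

theorem theorem2p7:
  fixes N :: nat and \<alpha> :: real
  assumes "1 \<le> N" and "0 < \<alpha>" and "\<alpha> < 1"
  shows "(\<forall>P \<in> (polynomials_upto N :: ('a::cbanach \<Rightarrow> 'b::cbanach) set).
            norm_scaled (s_radius \<alpha> N) P \<ge> (1 - \<alpha>) * norm_sup P) \<and>
         (\<forall>P \<in> (polynomials_upto N :: ('a \<Rightarrow> 'b) set).
            norm_weighted P \<ge> (1 - (s_radius \<alpha> N)\<^sup>2) * (1 - \<alpha>) * norm_sup P) \<and>
         equivalent_norms_on (polynomials_upto N :: ('a \<Rightarrow> 'b) set)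
            (norm_scaled (s_radius \<alpha> N)) norm_sup \<and>
         equivalent_norms_on (polynomials_upto N :: ('a \<Rightarrow> 'b) set)
            norm_weighted norm_sup \<and>
         equivalent_norms_on (polynomials_upto N :: ('a \<Rightarrow> 'b) set)
            (norm_scaled (s_radius \<alpha> N)) norm_weighted"
proof -
  let ?V = "polynomials_upto N :: ('a \<Rightarrow> 'b) set"
  define s where "s = s_radius \<alpha> N"
  have s: "0 < s" "s < 1" "s \<le> 1" "real N * (1 - s ^ N) \<le> \<alpha>"
    unfolding s_def using s_radius_bounds[OF assms] by auto
  have s2: "0 < 1 - s\<^sup>2"
    using s by (simp add: power_less_one_iff abs_square_less_1)
  have norms: "norm_on ?V (norm_scaled s)" "norm_on ?V norm_sup" "norm_on ?V norm_weighted"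
    using s by (simp_all add: norm_on_norm_scaled norm_on_norm_sup norm_on_norm_weighted)
  have nonneg: "0 \<le> norm_sup P" if "P \<in> ?V" for P
    using norms(2) that unfolding norm_on_def by blast
  \<comment> \<open>Replacing \<open>real N * (1 - s ^ N)\<close> by the larger
    \<open>\<alpha>\<close> lowers the left-hand side, because \<open>norm_sup P\<close> is
    nonnegative.\<close>
  have scaled: "(1 - \<alpha>) * norm_sup P \<le> norm_scaled s P" if "P \<in> ?V" for P
    using norm_sup_le_norm_scaled[OF that s(1,3)] nonneg[OF that] s(4)
      mult_right_mono[of "1 - \<alpha>" "1 - real N * (1 - s ^ N)" "norm_sup P"] by linarith
  have weighted: "(1 - s\<^sup>2) * (1 - \<alpha>) * norm_sup P \<le> norm_weighted P" if "P \<in> ?V" for P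
    unfolding mult.assoc
    by (rule order_trans[OF mult_left_mono[OF scaled[OF that]]
          norm_scaled_le_norm_weighted[OF that s(1,2)]]) (use s2 in simp)
  have "equivalent_norms_on ?V (norm_scaled s) norm_sup"
    by (rule equivalent_norms_onI[OF norms(1,2), where c = "1 - \<alpha>" and C = 1])
      (use scaled norm_scaled_le_norm_sup[OF _ s(1,3)] assms in auto)
  moreover have "equivalent_norms_on ?V norm_weighted norm_sup"
    by (rule equivalent_norms_onI[OF norms(3,2), where c = "(1 - s\<^sup>2) * (1 - \<alpha>)" and C = 1])
      (use weighted s2 assms in \<open>auto intro: norm_weighted_le_norm_sup\<close>)
  moreover have "equivalent_norms_on ?V (norm_scaled s) norm_weighted"
  \<comment> \<open>The lower constant comes from \<open>norm_weighted P \<le> norm_sup P\<close>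
    combined with \<open>scaled\<close>; the upper one from dividing the weight estimate by
    \<open>1 - s\<^sup>2\<close>.\<close>
  proof (rule equivalent_norms_onI[OF norms(1,3), where c = "1 - \<alpha>" and C = "1 / (1 - s\<^sup>2)"])
    fix P assume P: "P \<in> ?V"
    show "(1 - \<alpha>) * norm_weighted P \<le> norm_scaled s P"
      using scaled[OF P] mult_left_mono[OF norm_weighted_le_norm_sup[OF P], of "1 - \<alpha>"] assms
      by linarith
    show "norm_scaled s P \<le> 1 / (1 - s\<^sup>2) * norm_weighted P"
      using norm_scaled_le_norm_weighted[OF P s(1,2)] s2
      by (simp add: pos_le_divide_eq mult.commute)
  qed (use s2 assms in auto)
  ultimately show ?thesis
    unfolding s_def[symmetric] using scaled weighted by blast
qed

end
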